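(* Let $(X,\mathcal{I})$ be a matroid of rank $K$ on a finite set $X$ and $f:\mathcal{I}\rightarrow\mathbb{R}$ a polymatroid function. Let $\Omega_f$ be the set of all polymatroid functions $g:2^X\rightarrow\mathbb{R}$ that agree with $f$ on $\mathcal{I}$. If there exists an extension of $f$ to the entire power set (i.e. $\Omega_f\neq\emptyset$), then any greedy solution $G$ to the problem of maximizing $f(M)$ subject to $M\in\mathcal{I}$ satisfies $$\frac{f(G)}{f(O)}\geq\frac{1}{1+d},$$ where $O$ is an optimal solution and $d=\inf_{g\in\Omega_f}c(g)$, with $c(g)$ the total curvature of $g$. In particular, when $(X,\mathcal{I})$ is a uniform matroid (and $d>0$), any greedy solution $G$ satisfies $$\frac{f(G)}{f(O)}\geq\frac{1}{d}\left(1-\left(1-\frac{d}{K}\right)^K\right)>\frac{1}{d}\left(1-e^{-d}\right).$$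
   Context: A function $h:\mathcal{J}\rightarrow\mathbb{R}$, where $\mathcal{J}$ is the collection of independent sets of a matroid on $X$ (including $\mathcal{J}=2^X$), is a polymatroid function if $h(\emptyset)=0$, $h$ is monotone ($h(A)\leq h(B)$ for all $A\subseteq B$ with $A,B\in\mathcal{J}$), and $h$ is submodular ($h(A\cup\{j\})-h(A)\geq h(B\cup\{j\})-h(B)$ for all $A\subseteq B$ and $j\in X\setminus B$ with $B\cup\{j\}\in\mathcal{J}$). The total curvature of $g:2^X\rightarrow\mathbb{R}$ is $$c(g)=\max_{j\in X,\ g(\{j\})\neq g(\emptyset)}\left\{1-\frac{g(X)-g(X\setminus\{j\})}{g(\{j\})-g(\emptyset)}\right\}.$$ An optimal solution is a set $O\in\operatorname{argmax}_{M\in\mathcal{I}}f(M)$. A greedy solution is a set $G=\{g_1,\ldots,g_K\}$ of $K$ distinct elements with $g_1\in\operatorname{argmax}_{\{g\}\in\mathcal{I}}f(\{g\})$ and, for $i=2,\ldots,K$, $g_i\in\operatorname{argmax} f(\{g_1,\ldots,g_{i-1},g\})$, the argmax being over $g\in X\setminus\{g_1,\ldots,g_{i-1}\}$ with $\{g_1,\ldots,g_{i-1},g\}\in\mathcal{I}$. The uniform matroid of rank $K$ on $X$ ($K\le |X|$) has $\mathcal{I}=\{S\subseteq X:|S|\leq K\}$. It is assumed that $f(O)>0$, so that the ratios and the curvatures $c(g)$ are well defined. *)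

theory Defs
  imports Complex_Main
begin

locale matroid =
  fixes X :: "'a set" and \<I> :: "'a set set"
  assumes finite_ground: "finite X"
    and indep_subset_ground: "A \<in> \<I> \<Longrightarrow> A \<subseteq> X"
    and indep_empty: "{} \<in> \<I>"
    and indep_subset: "A \<in> \<I> \<Longrightarrow> B \<subseteq> A \<Longrightarrow> B \<in> \<I>"
    and indep_augment:
      "A \<in> \<I> \<Longrightarrow> B \<in> \<I> \<Longrightarrow> card A < card B \<Longrightarrow> \<exists>x\<in>B - A. insert x A \<in> \<I>"

definition matroid_rank :: "'a set set \<Rightarrow> nat" where
  "matroid_rank \<I> = Max (card ` \<I>)"

definition uniform_matroid :: "'a set \<Rightarrow> 'a set set \<Rightarrow> nat \<Rightarrow> bool" where
  "uniform_matroid X \<I> K \<longleftrightarrow> finite X \<and> K \<le> card X \<and> \<I> = {S. S \<subseteq> X \<and> card S \<le> K}"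

text \<open>Set functions are total in HOL; only the values of \<open>h\<close> on the family \<open>\<J>\<close> are constrained.
  Taking \<open>\<J> = Pow X\<close> gives polymatroid functions on the entire power set.\<close>

definition polymatroid_fun :: "'a set \<Rightarrow> 'a set set \<Rightarrow> ('a set \<Rightarrow> real) \<Rightarrow> bool" where
  "polymatroid_fun X \<J> h \<longleftrightarrow>
     h {} = 0 \<and>
     (\<forall>A\<in>\<J>. \<forall>B\<in>\<J>. A \<subseteq> B \<longrightarrow> h A \<le> h B) \<and>
     (\<forall>A B j. A \<subseteq> B \<and> j \<in> X - B \<and> B \<union> {j} \<in> \<J> \<longrightarrow>
        h (A \<union> {j}) - h A \<ge> h (B \<union> {j}) - h B)"

text \<open>Extensions may differ outside \<open>Pow X\<close>; such values do not affect the total curvature below.\<close>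

definition polymatroid_extensions ::
    "'a set \<Rightarrow> 'a set set \<Rightarrow> ('a set \<Rightarrow> real) \<Rightarrow> ('a set \<Rightarrow> real) set" where
  "polymatroid_extensions X \<I> f =
     {g. polymatroid_fun X (Pow X) g \<and> (\<forall>A\<in>\<I>. g A = f A)}"

definition total_curvature :: "'a set \<Rightarrow> ('a set \<Rightarrow> real) \<Rightarrow> real" where
  "total_curvature X g =
     Max ((\<lambda>j. 1 - (g X - g (X - {j})) / (g {j} - g {})) ` {j \<in> X. g {j} \<noteq> g {}})"

definition optimal_solution :: "'a set set \<Rightarrow> ('a set \<Rightarrow> real) \<Rightarrow> 'a set \<Rightarrow> bool" where
  "optimal_solution \<I> f S \<longleftrightarrow> is_arg_max f (\<lambda>M. M \<in> \<I>) S"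

text \<open>The case \<open>i = 1\<close>, where \<open>s ` {1..<i}\<close> is empty, is the choice of the first element.\<close>

definition greedy_solution ::
    "'a set \<Rightarrow> 'a set set \<Rightarrow> ('a set \<Rightarrow> real) \<Rightarrow> nat \<Rightarrow> 'a set \<Rightarrow> bool" where
  "greedy_solution X \<I> f K G \<longleftrightarrow>
     (\<exists>s :: nat \<Rightarrow> 'a. inj_on s {1..K} \<and> G = s ` {1..K} \<and>
        (\<forall>i\<in>{1..K}.
           is_arg_max (\<lambda>x. f (s ` {1..<i} \<union> {x}))
             (\<lambda>x. x \<in> X - s ` {1..<i} \<and> s ` {1..<i} \<union> {x} \<in> \<I>) (s i)))"

end

theory Submission imports Defs begin

text \<open>
  Fix an extension \<open>g\<close> of curvature \<open>c\<close>, with greedy sets \<open>S\<^sub>t\<close> and gains \<open>\<Delta>\<^sub>t\<close>. Adding the greedy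
  elements to an optimal set one by one bounds \<open>g (Opt \<union> S\<^sub>t)\<close> from below through the curvature;
  adding the optimal elements to \<open>S\<^sub>t\<close> bounds it from above through submodularity. For a matroid,
  the augmentation axiom pairs the elements of \<open>Opt - G\<close> with greedy steps outside \<open>Opt\<close>, and
  taking \<open>t = K\<close> gives \<open>f Opt \<le> (1 + c) f G\<close>. For a uniform matroid, all \<open>t < K\<close> give a linear
  recursion for the gains, whose worst case is \<open>G \<inter> Opt = {}\<close>. Both bounds depend
  continuously on \<open>c\<close>, so they pass to the infimum over all extensions.
\<close>

section \<open>The recursion for the uniform matroid\<close>

text \<open>For \<open>k > 0\<close> and \<open>c \<noteq> 0\<close> this is
  \<open>(1 - (1 - c / k) ^ m) / c\<close>; the geometric sum also covers curvature 0. It is the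
  share of a residual value that \<open>m\<close> greedy steps guarantee when \<open>k\<close>
  bounds the number of optimal elements still missing.\<close>

definition greedy_ratio :: "real \<Rightarrow> nat \<Rightarrow> nat \<Rightarrow> real" where
  "greedy_ratio c k m = (\<Sum>i<m. (1 - c / real k) ^ i) / real k"

lemma greedy_ratio_0 [simp]: "greedy_ratio c k 0 = 0"
  by (simp add: greedy_ratio_def)

lemma greedy_ratio_Suc:
  "greedy_ratio c k (Suc m) = 1 / real k + (1 - c / real k) * greedy_ratio c k m"
  unfolding greedy_ratio_def
  by (simp add: sum.lessThan_Suc_shift sum_distrib_left add_divide_distrib del: sum.lessThan_Suc)

lemma one_minus_div_bounds:
  fixes c :: real
  assumes "0 \<le> c" "c \<le> 1"
  shows "0 \<le> 1 - c / real k" "1 - c / real k \<le> 1"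
  using assms by (cases k; simp add: field_simps)+

lemma greedy_ratio_nonneg:
  assumes "0 \<le> c" "c \<le> 1"
  shows "0 \<le> greedy_ratio c k m"
  unfolding greedy_ratio_def using one_minus_div_bounds[OF assms, of k]
  by (intro divide_nonneg_nonneg sum_nonneg) auto

lemma greedy_ratio_le_1:
  assumes "0 \<le> c" "c \<le> 1" "m \<le> k"
  shows "greedy_ratio c k m \<le> 1"
proof -
  have "(\<Sum>i<m. (1 - c / real k) ^ i) \<le> (\<Sum>i<m. 1)"
    using one_minus_div_bounds[OF assms(1,2), of k] by (intro sum_mono power_le_one) auto
  also have "\<dots> \<le> real k" using assms(3) by simp
  finally show ?thesis unfolding greedy_ratio_def by (cases "k = 0") (auto simp: divide_le_eq_1)
qed

lemma mult_greedy_ratio: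
  assumes "k > 0"
  shows "c * greedy_ratio c k m = 1 - (1 - c / real k) ^ m"
  using one_diff_power_eq[of "1 - c / real k" m] assms
  by (simp add: greedy_ratio_def)

text \<open>Write \<open>1 - c / n = q * (1 - y)\<close> with \<open>q = 1 - c / (n + 1)\<close>.
  After splitting off \<open>q ^ i\<close> it suffices that \<open>q \<le> (1 - y) ^ i\<close>,
  which Bernoulli's inequality provides.\<close>

lemma power_one_minus_div_Suc_le:
  fixes c :: real
  assumes c: "0 \<le> c" "c \<le> 1" and i: "i < n"
  shows "(1 - c / real (Suc n)) ^ Suc i \<le> (1 - c / real n) ^ i"
proof -
  let ?q = "1 - c / real (Suc n)" and ?y = "c / (real n * (real n + 1 - c))"
  have n: "real n \<ge> 1" using i by simp
  have pos: "real n + 1 - c > 0" "real n * (real n + 1 - c) > 0" using n c by auto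
  have fac: "1 - c / real n = ?q * (1 - ?y)"
    using n pos by (simp add: divide_simps) (simp add: algebra_simps)
  have "?y \<le> 1"
  proof -
    have "1 * c \<le> real n * (real n + 1 - c)" using n c by (intro mult_mono) auto
    then show ?thesis using pos(2) by (simp only: pos_divide_le_eq mult_1)
  qed
  have "?q \<le> 1 - real i * ?y"
  proof -
    \<comment> \<open>Here \<open>i \<le> n - 1\<close> enters; the chain amounts to
      \<open>i * y \<le> c / (n + 1)\<close>.\<close>
    have "real i * (real n + 1) \<le> (real n - 1) * (real n + 1)"
      using i by (intro mult_right_mono) auto
    also have "\<dots> \<le> real n * (real n + 1 - c)"
      using mult_left_mono[OF c(2), of "real n"] by (simp add: algebra_simps)
    finally have "c * (real i * (real n + 1)) \<le> c * (real n * (real n + 1 - c))"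
      using c by (intro mult_left_mono)
    then have "real i * ?y \<le> c / (real n + 1)"
      using frac_le_eq[of "real n * (real n + 1 - c)" "real n + 1" "real i * c" c] pos n
      by (simp add: divide_le_0_iff mult_ac)
    then show ?thesis by (simp add: add.commute)
  qed
  also have "\<dots> \<le> (1 - ?y) ^ i"
    using Bernoulli_inequality[of "- ?y" i] \<open>?y \<le> 1\<close> by simp
  finally have "?q ^ i * ?q \<le> ?q ^ i * (1 - ?y) ^ i"
    using one_minus_div_bounds(1)[OF c, of "Suc n"] by (intro mult_left_mono) simp_all
  then show ?thesis by (simp only: fac power_mult_distrib power_Suc mult.commute)
qed

text \<open>Termwise comparison of the two geometric sums. It shows that a step on an optimal
  element, which lowers \<open>k\<close> by one, guarantees at least as much as a step outside the
  optimal set.\<close>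

lemma greedy_ratio_shared_step:
  assumes c: "0 \<le> c" "c \<le> 1" and m: "m \<le> k"
  shows "greedy_ratio c (Suc k) (Suc m)
    \<le> 1 / real (Suc k) + (1 - 1 / real (Suc k)) * greedy_ratio c k m"
proof -
  have "(\<Sum>i<m. (1 - c / real (Suc k)) ^ Suc i) \<le> (\<Sum>i<m. (1 - c / real k) ^ i)"
    using m by (intro sum_mono power_one_minus_div_Suc_le c) auto
  moreover have "(1 - 1 / real (Suc k)) * greedy_ratio c k m
      = (\<Sum>i<m. (1 - c / real k) ^ i) / real (Suc k)"
  proof -
    have "1 - 1 / real (Suc k) = real k / real (Suc k)" by (simp add: field_simps)
    then show ?thesis using m by (cases "k = 0") (auto simp: greedy_ratio_def)
  qed
  ultimately show ?thesis
    unfolding greedy_ratio_def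
    by (simp add: sum.lessThan_Suc_shift divide_right_mono flip: add_divide_distrib
        del: sum.lessThan_Suc)
qed

text \<open>\<open>R\<close> is the residual value, \<open>k\<close> bounds the missing optimal
  elements, and \<open>b t\<close> says that step \<open>t\<close> picks one of them. Inserting the
  induction hypothesis, with ratio \<open>v\<close>, leaves \<open>x t\<close> with the nonnegative
  coefficient \<open>1 - v\<close> or \<open>1 - c * v\<close>, so \<open>x t\<close> may be
  replaced by its lower bound \<open>R t / k t\<close>.\<close>

lemma gain_recursion_bound:
  fixes x R :: "nat \<Rightarrow> real" and k :: "nat \<Rightarrow> nat"
  assumes c: "0 \<le> c" "c \<le> 1"
    and x: "\<And>t. t < N \<Longrightarrow> 0 \<le> x t"
    and R: "\<And>t. t < N \<Longrightarrow> R (Suc t) = R t - (if b t then 1 else c) * x t"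
    and k: "\<And>t. t < N \<Longrightarrow> k (Suc t) = (if b t then k t - 1 else k t)"
    and gain: "\<And>t. t < N \<Longrightarrow> R t \<le> real (k t) * x t"
    and "t + m = N" "m \<le> k t"
  shows "R t * greedy_ratio c (k t) m \<le> (\<Sum>i=t..<N. x i)"
  using \<open>t + m = N\<close> \<open>m \<le> k t\<close>
proof (induction m arbitrary: t)
  case 0
  then show ?case by simp
next
  case (Suc m)
  from Suc.prems have t: "t < N" "Suc t + m = N" by auto
  obtain k' where k': "k t = Suc k'" and m: "m \<le> k'" using Suc.prems by (cases "k t") auto
  let ?K = "real (Suc k')"
  have xR: "R t / ?K \<le> x t"
    using gain[OF t(1)] by (simp add: k' divide_le_eq mult.commute)
  have sum: "(\<Sum>i=t..<N. x i) = x t + (\<Sum>i=Suc t..<N. x i)"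
    using t by (simp add: sum.atLeast_Suc_lessThan)
  show ?case
  \<comment> \<open>The shared case multiplies a comparison of ratios by \<open>R t\<close>; a
    negative residual makes the claim trivial.\<close>
  proof (cases "R t \<ge> 0")
    case False
    then have "R t * greedy_ratio c (k t) (Suc m) \<le> 0"
      using greedy_ratio_nonneg[OF c] by (simp add: mult_nonpos_nonneg)
    also have "0 \<le> (\<Sum>i=t..<N. x i)" using x by (intro sum_nonneg) auto
    finally show ?thesis .
  next
    case True
    show ?thesis
    proof (cases "b t")
      case True
      let ?v = "greedy_ratio c k' m"
      have "R (Suc t) * ?v \<le> (\<Sum>i=Suc t..<N. x i)"
        using Suc.IH[OF t(2)] m True k[OF t(1)] k' by simp
      then have "x t * (1 - ?v) + R t * ?v \<le> (\<Sum>i=t..<N. x i)"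
        using True by (simp add: sum R[OF t(1)] algebra_simps)
      moreover have "R t / ?K * (1 - ?v) \<le> x t * (1 - ?v)"
        using xR greedy_ratio_le_1[OF c m] by (intro mult_right_mono) auto
      moreover have "R t * greedy_ratio c (k t) (Suc m) \<le> R t * (1 / ?K + (1 - 1 / ?K) * ?v)"
        unfolding k' using greedy_ratio_shared_step[OF c m] \<open>R t \<ge> 0\<close> by (intro mult_left_mono)
      moreover have "R t * (1 / ?K + (1 - 1 / ?K) * ?v) = R t / ?K * (1 - ?v) + R t * ?v"
        by (simp add: algebra_simps diff_divide_distrib)
      ultimately show ?thesis by linarith
    next
      case False
      let ?v = "greedy_ratio c (Suc k') m"
      have v: "0 \<le> ?v" "?v \<le> 1"
        using greedy_ratio_nonneg[OF c] greedy_ratio_le_1[OF c] m by auto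
      have "R (Suc t) * ?v \<le> (\<Sum>i=Suc t..<N. x i)"
        using Suc.IH[OF t(2)] m False k[OF t(1)] k' by simp
      then have "x t * (1 - c * ?v) + R t * ?v \<le> (\<Sum>i=t..<N. x i)"
        using False by (simp add: sum R[OF t(1)] algebra_simps)
      moreover have "R t / ?K * (1 - c * ?v) \<le> x t * (1 - c * ?v)"
        using xR mult_le_one[OF c(2) v] by (intro mult_right_mono) auto
      \<comment> \<open>An identity, unlike in the shared case: steps outside the optimal set
        determine the ratio.\<close>
      moreover have "R t * greedy_ratio c (k t) (Suc m) = R t / ?K * (1 - c * ?v) + R t * ?v"
        unfolding k' greedy_ratio_Suc by (simp add: algebra_simps diff_divide_distrib)
      ultimately show ?thesis by linarith
    qed
  qed
qed

section \<open>Polymatroid functions on the power set\<close>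

locale powerset_polymatroid =
  fixes X :: "'a set" and g :: "'a set \<Rightarrow> real"
  assumes finite_X: "finite X" and polymatroid: "polymatroid_fun X (Pow X) g"
begin

lemma empty_eq_0 [simp]: "g {} = 0"
  using polymatroid by (simp add: polymatroid_fun_def)

lemma mono: "A \<subseteq> B \<Longrightarrow> B \<subseteq> X \<Longrightarrow> g A \<le> g B"
  using polymatroid by (auto simp: polymatroid_fun_def)

lemma nonneg: "A \<subseteq> X \<Longrightarrow> 0 \<le> g A"
  using mono[of "{}" A] by simp

text \<open>Submodularity extended to \<open>j \<in> B\<close>, where the left side is 0 and
  monotonicity suffices.\<close>

lemma marginal_antimono:
  assumes "A \<subseteq> B" "B \<subseteq> X" "j \<in> X"
  shows "g (insert j B) - g B \<le> g (insert j A) - g A"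
proof (cases "j \<in> B")
  case True
  then show ?thesis using mono[of A "insert j A"] assms by (auto simp: insert_absorb)
next
  case False
  then show ?thesis using polymatroid assms by (auto simp: polymatroid_fun_def)
qed

lemma union_le:
  assumes "A \<subseteq> X" "T \<subseteq> X"
  shows "g (A \<union> T) \<le> g A + (\<Sum>j\<in>T - A. g (insert j A) - g A)"
proof -
  have "finite T" using assms finite_X finite_subset by blast
  then show ?thesis using assms(2)
  proof (induction T rule: finite_induct)
    case empty
    then show ?case by simp
  next
    case (insert j T)
    then have IH: "g (A \<union> T) \<le> g A + (\<Sum>j\<in>T - A. g (insert j A) - g A)" by simp
    have marg: "g (insert j (A \<union> T)) - g (A \<union> T) \<le> g (insert j A) - g A"
      using marginal_antimono[of A "A \<union> T" j] insert.prems assms by auto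
    show ?case
      using IH marg insert.hyps by (cases "j \<in> A") (auto simp: insert_Diff_if insert_absorb)
  qed
qed

context
  assumes nonzero: "\<exists>A\<subseteq>X. g A \<noteq> 0"
begin

text \<open>Makes the \<open>Max\<close> in \<open>total_curvature\<close> range over a nonempty
  set: if every singleton had value 0, subadditivity would make \<open>g\<close> vanish on all
  subsets of \<open>X\<close>.\<close>

lemma nonzero_singleton: "{j \<in> X. g {j} \<noteq> g {}} \<noteq> {}"
proof
  assume none: "{j \<in> X. g {j} \<noteq> g {}} = {}"
  obtain A where A: "A \<subseteq> X" "g A \<noteq> 0" using nonzero by blast
  then have "g A \<le> (\<Sum>j\<in>A. g {j})" using union_le[of "{}" A] by simp
  also have "\<dots> = 0" using none A by (intro sum.neutral) auto
  finally show False using nonneg[OF A(1)] A(2) by simp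
qed

lemma curvature_ratio_bounds:
  assumes "j \<in> X" "g {j} \<noteq> g {}"
  shows "0 \<le> 1 - (g X - g (X - {j})) / (g {j} - g {})"
    "1 - (g X - g (X - {j})) / (g {j} - g {}) \<le> 1"
proof -
  have "0 < g {j}" using nonneg[of "{j}"] assms by auto
  moreover have "g X - g (X - {j}) \<le> g {j}"
    using marginal_antimono[of "{}" "X - {j}" j] assms by (simp add: insert_absorb)
  moreover have "g (X - {j}) \<le> g X" by (intro mono) auto
  ultimately show "0 \<le> 1 - (g X - g (X - {j})) / (g {j} - g {})"
    "1 - (g X - g (X - {j})) / (g {j} - g {}) \<le> 1" by auto
qed

lemma total_curvature_nonneg: "0 \<le> total_curvature X g"
proof -
  obtain j where "j \<in> {j \<in> X. g {j} \<noteq> g {}}" using nonzero_singleton by blast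
  then show ?thesis
    unfolding total_curvature_def using finite_X curvature_ratio_bounds(1)[of j]
    by (subst Max_ge_iff) (fastforce simp del: empty_eq_0)+
qed

lemma total_curvature_le_1: "total_curvature X g \<le> 1"
  unfolding total_curvature_def using finite_X nonzero_singleton curvature_ratio_bounds(2)
  by (subst Max_le_iff) (auto simp del: empty_eq_0)

text \<open>By submodularity the marginal of \<open>j\<close> is smallest at \<open>X - {j}\<close>,
  where the curvature bounds it. If \<open>g {j} = 0\<close>, the maximum skips \<open>j\<close> and
  monotonicity suffices.\<close>

lemma marginal_ge:
  assumes "A \<subseteq> X" "j \<in> X" "j \<notin> A"
  shows "(1 - total_curvature X g) * g {j} \<le> g (insert j A) - g A"
proof (cases "g {j} = 0")
  case True
  then show ?thesis using mono[of A "insert j A"] assms by auto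
next
  case False
  then have pos: "0 < g {j}" using nonneg[of "{j}"] assms by auto
  have "1 - (g X - g (X - {j})) / (g {j} - g {}) \<le> total_curvature X g"
    unfolding total_curvature_def using finite_X assms False by (intro Max_ge) auto
  then have "(1 - total_curvature X g) * g {j} \<le> g X - g (X - {j})"
    using pos by (simp add: field_simps)
  also have "\<dots> \<le> g (insert j A) - g A"
    using marginal_antimono[of A "X - {j}" j] assms by (auto simp: insert_absorb)
  finally show ?thesis .
qed

end

end

section \<open>Greedy runs\<close>

locale greedy_run = powerset_polymatroid X g + matroid X \<I>
  for X :: "'a set" and g :: "'a set \<Rightarrow> real" and \<I> :: "'a set set" +
  fixes r :: "nat \<Rightarrow> 'a" and K :: nat
  assumes inj: "inj_on r {..<K}"
    and step_indep: "t < K \<Longrightarrow> r ` {..<Suc t} \<in> \<I>"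
    and step_max: "t < K \<Longrightarrow> x \<in> X - r ` {..<t} \<Longrightarrow> insert x (r ` {..<t}) \<in> \<I>
      \<Longrightarrow> g (insert x (r ` {..<t})) \<le> g (r ` {..<Suc t})"
    and nonzero_value: "\<exists>A\<subseteq>X. g A \<noteq> 0"
begin

abbreviation S :: "nat \<Rightarrow> 'a set" where
  "S t \<equiv> r ` {..<t}"

abbreviation gain :: "nat \<Rightarrow> real" where
  "gain t \<equiv> g (S (Suc t)) - g (S t)"

abbreviation curv :: real where
  "curv \<equiv> total_curvature X g"

lemma S_Suc: "S (Suc t) = insert (r t) (S t)"
  by (simp add: lessThan_Suc)

lemma S_indep: "t \<le> K \<Longrightarrow> S t \<in> \<I>"
  using step_indep indep_empty by (cases t) auto

lemma S_subset: "t \<le> K \<Longrightarrow> S t \<subseteq> X"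
  using S_indep indep_subset_ground by blast

lemma r_notin_S: "t < K \<Longrightarrow> r t \<notin> S t"
  using inj by (force simp: inj_on_def)

lemma r_in_X: "t < K \<Longrightarrow> r t \<in> X"
  using S_subset[of "Suc t"] by auto

lemma card_S: "t \<le> K \<Longrightarrow> card (S t) = t"
  using card_image[OF inj_on_subset[OF inj, of "{..<t}"]] by auto

lemma gain_nonneg: "t < K \<Longrightarrow> 0 \<le> gain t"
  using mono[of "S t" "S (Suc t)"] S_subset[of "Suc t"] by (simp add: S_Suc subset_insertI)

lemma sum_gain: "(\<Sum>i<t. gain i) = g (S t)"
  using sum_lessThan_telescope[of "\<lambda>i. g (S i)" t] by simp

text \<open>Each greedy element outside \<open>T\<close> adds at least
  \<open>(1 - curv) * g {r t}\<close> when it joins \<open>T \<union> S t\<close>, and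
  \<open>g {r t}\<close> is at least its greedy gain.\<close>

lemma curvature_union_ge:
  assumes "T \<subseteq> X" "t \<le> K"
  shows "g T + (1 - curv) * (\<Sum>i<t. if r i \<in> T then 0 else gain i) \<le> g (T \<union> S t)"
  using assms(2)
proof (induction t)
  case 0
  then show ?case by simp
next
  case (Suc t)
  then have t: "t < K" and IH:
    "g T + (1 - curv) * (\<Sum>i<t. if r i \<in> T then 0 else gain i) \<le> g (T \<union> S t)" by auto
  show ?case
  proof (cases "r t \<in> T")
    case True
    then have "T \<union> S (Suc t) = T \<union> S t" by (auto simp: S_Suc)
    then show ?thesis using IH True by simp
  next
    case False
    have sub: "T \<union> S t \<subseteq> X" using assms S_subset[of t] t by auto
    have "gain t \<le> g {r t}"
      using marginal_antimono[of "{}" "S t" "r t"] S_subset[of t] r_in_X[OF t] t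
      by (simp add: S_Suc)
    then have "(1 - curv) * gain t \<le> (1 - curv) * g {r t}"
      using total_curvature_le_1[OF nonzero_value] by (intro mult_left_mono) auto
    also have "\<dots> \<le> g (insert (r t) (T \<union> S t)) - g (T \<union> S t)"
      using marginal_ge[OF nonzero_value sub] r_in_X[OF t] r_notin_S[OF t] False by auto
    finally have "(1 - curv) * gain t \<le> g (T \<union> S (Suc t)) - g (T \<union> S t)"
      by (simp add: S_Suc)
    then show ?thesis using IH False by (simp add: algebra_simps)
  qed
qed

lemma gain_max:
  assumes "t < K" "x \<in> X" "insert x (S t) \<in> \<I>"
  shows "g (insert x (S t)) - g (S t) \<le> gain t"
proof (cases "x \<in> S t")
  case True
  then show ?thesis using gain_nonneg[OF assms(1)] by (simp add: insert_absorb)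
next
  case False
  then show ?thesis using step_max[of t x] assms by simp
qed

text \<open>The induction on \<open>t\<close> builds, from the last greedy step backwards, an injection of \<open>T - G\<close> into
  the greedy steps outside \<open>T\<close>: step \<open>t\<close> takes itself if it belongs to \<open>T\<close>, and otherwise an
  element of \<open>T\<close> by which \<open>S t\<close> can be augmented.\<close>

lemma sum_marginals_le_gains:
  assumes "t \<le> K" "T \<in> \<I>" "card T \<le> t"
  shows "(\<Sum>j\<in>T - S t. g (insert j (S K)) - g (S K)) \<le> (\<Sum>i<t. if r i \<in> T then 0 else gain i)"
  using assms
proof (induction t arbitrary: T)
  case 0
  then have "finite T" using finite_X indep_subset_ground finite_subset by blast
  with 0 show ?case by simp
next
  case (Suc t)
  let ?rho = "\<lambda>j. g (insert j (S K)) - g (S K)"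
  have t: "t < K" using Suc.prems by simp
  have T: "T \<subseteq> X" "finite T"
    using Suc.prems finite_X indep_subset_ground finite_subset by blast+
  have card_le: "card (T - {j}) \<le> t" if "j \<in> T" for j
    using T(2) that Suc.prems by (simp add: card_Diff_singleton)
  have sub_indep: "T - {j} \<in> \<I>" for j using indep_subset[OF Suc.prems(2)] by blast
  consider "r t \<in> T" | "r t \<notin> T" "card T \<le> t" | "r t \<notin> T" "card T = Suc t"
    using Suc.prems by linarith
  then show ?case
  proof cases
    \<comment> \<open>Removing \<open>r t\<close> from \<open>T\<close> leaves the earlier terms
      unchanged, because \<open>r\<close> is injective.\<close>
    case 1
    have "T - S (Suc t) = (T - {r t}) - S t" by (auto simp: S_Suc)
    moreover have "(\<Sum>i<t. if r i \<in> T - {r t} then 0 else gain i)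
        = (\<Sum>i<t. if r i \<in> T then 0 else gain i)"
      using r_notin_S[OF t] by (intro sum.cong) (auto intro: rev_image_eqI)
    ultimately show ?thesis
      using Suc.IH[OF _ sub_indep card_le[OF 1]] t 1 by simp
  next
    case 2
    then have "T - S (Suc t) = T - S t" by (auto simp: S_Suc)
    then show ?thesis using Suc.IH[OF _ Suc.prems(2) 2(2)] 2 t gain_nonneg[OF t] by simp
  next
    case 3
    then obtain j where j: "j \<in> T - S t" "insert j (S t) \<in> \<I>"
      using indep_augment[OF S_indep Suc.prems(2), of t] card_S[of t] t by auto
    have "T - S (Suc t) = insert j ((T - {j}) - S t)" using 3 j by (auto simp: S_Suc)
    then have "(\<Sum>j\<in>T - S (Suc t). ?rho j) = ?rho j + (\<Sum>j\<in>(T - {j}) - S t. ?rho j)"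
      using T(2) by simp
    moreover have "(\<Sum>i<t. if r i \<in> T - {j} then 0 else gain i)
        = (\<Sum>i<t. if r i \<in> T then 0 else gain i)"
      using j by (intro sum.cong) auto
    moreover have "?rho j \<le> gain t"
    proof -
      \<comment> \<open>Since \<open>S t \<subseteq> S K\<close>, the marginal can be moved back to
        step \<open>t\<close>, where \<open>j\<close> was an admissible candidate.\<close>
      have "?rho j \<le> g (insert j (S t)) - g (S t)"
        using t j T S_subset[of K] by (intro marginal_antimono) auto
      also have "\<dots> \<le> gain t" using gain_max[OF t] j T by auto
      finally show ?thesis .
    qed
    ultimately show ?thesis
      using Suc.IH[OF _ sub_indep card_le, of j] t j 3 by simp
  qed
qed

text \<open>Comparing the lower and upper bounds on \<open>g (S K \<union> T)\<close> leaves
  \<open>curv\<close> times the gains outside \<open>T\<close>, and these sum to at most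
  \<open>g (S K)\<close>.\<close>

lemma matroid_bound:
  assumes "T \<in> \<I>" "card T \<le> K"
  shows "g T \<le> (1 + curv) * g (S K)"
proof -
  let ?d = "\<Sum>i<K. if r i \<in> T then 0 else gain i"
  have T: "T \<subseteq> X" using assms indep_subset_ground by blast
  have "g T + (1 - curv) * ?d \<le> g (S K \<union> T)"
    using curvature_union_ge[OF T, of K] by (simp add: Un_commute)
  also have "\<dots> \<le> g (S K) + ?d"
    using union_le[OF S_subset T, of K] sum_marginals_le_gains[OF _ assms] by simp
  finally have "g T \<le> g (S K) + curv * ?d" by (simp add: algebra_simps)
  moreover have "?d \<le> (\<Sum>i<K. gain i)" using gain_nonneg by (intro sum_mono) auto
  then have "curv * ?d \<le> curv * g (S K)"
    unfolding sum_gain using total_curvature_nonneg[OF nonzero_value] by (intro mult_left_mono)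
  ultimately show ?thesis by (simp add: algebra_simps)
qed

text \<open>In a uniform matroid every element of \<open>T - S t\<close> is a candidate at each step
  \<open>t < K\<close>, so the two bounds on \<open>g (S t \<union> T)\<close> can be compared at
  every step, which yields the gain recursion.\<close>

lemma uniform_bound:
  assumes uniform: "\<And>A. A \<subseteq> X \<Longrightarrow> card A \<le> K \<Longrightarrow> A \<in> \<I>"
    and T: "T \<subseteq> X" "card T \<le> K"
  shows "g T * greedy_ratio curv K K \<le> g (S K)"
proof -
  \<comment> \<open>Equals the lower bound on \<open>g (T \<union> S t)\<close> minus
    \<open>g (S t)\<close>: gains outside \<open>T\<close> count only with weight
    \<open>curv\<close>.\<close>
  define R where "R t = g T - (\<Sum>i<t. (if r i \<in> T then 1 else curv) * gain i)" for t
  \<comment> \<open>Starting from \<open>K\<close> rather than \<open>card T\<close> gives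
    \<open>k 0 = K\<close>, enough for all \<open>K\<close> steps of the recursion.\<close>
  define k where "k t = K - card (T \<inter> S t)" for t
  have finT: "finite T" using T finite_X finite_subset by blast
  have k_Suc: "k (Suc t) = (if r t \<in> T then k t - 1 else k t)" if t: "t < K" for t
    using r_notin_S[OF t] finT by (simp add: k_def S_Suc Int_insert_right)
  have R_le: "R t \<le> real (k t) * gain t" if t: "t < K" for t
  proof -
    have St: "S t \<subseteq> X" "finite (S t)" using S_subset t by auto
    have "g T + (1 - curv) * (\<Sum>i<t. if r i \<in> T then 0 else gain i) \<le> g (S t \<union> T)"
      using curvature_union_ge[OF T(1), of t] t by (simp add: Un_commute)
    also have "\<dots> \<le> g (S t) + (\<Sum>j\<in>T - S t. g (insert j (S t)) - g (S t))"
      by (rule union_le[OF St(1) T(1)])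
    also have "(\<Sum>j\<in>T - S t. g (insert j (S t)) - g (S t)) \<le> (\<Sum>j\<in>T - S t. gain t)"
    proof (intro sum_mono gain_max t)
      fix j assume j: "j \<in> T - S t"
      then show "j \<in> X" using T by auto
      then show "insert j (S t) \<in> \<I>"
        using j St t card_S[of t] by (intro uniform) auto
    qed
    also have "\<dots> \<le> real (k t) * gain t"
    proof -
      have "card (T - S t) \<le> k t"
        using T(2) card_Diff_subset_Int[of T "S t"] St(2) unfolding k_def by simp
      then show ?thesis using gain_nonneg[OF t] by (simp add: mult_right_mono)
    qed
    finally have "g T + (1 - curv) * (\<Sum>i<t. if r i \<in> T then 0 else gain i)
      \<le> (\<Sum>i<t. gain i) + real (k t) * gain t"
      unfolding sum_gain by simp
    moreover have "(\<Sum>i<t. (if r i \<in> T then 1 else curv) * gain i)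
      = (\<Sum>i<t. gain i) - (1 - curv) * (\<Sum>i<t. if r i \<in> T then 0 else gain i)"
      unfolding sum_distrib_left sum_subtractf[symmetric]
      by (intro sum.cong) (auto simp: algebra_simps)
    ultimately show ?thesis unfolding R_def by linarith
  qed
  have "R 0 * greedy_ratio curv (k 0) K \<le> (\<Sum>i=0..<K. gain i)"
    by (rule gain_recursion_bound[where b = "\<lambda>t. r t \<in> T"])
      (use total_curvature_nonneg[OF nonzero_value] total_curvature_le_1[OF nonzero_value]
        gain_nonneg k_Suc R_le in \<open>auto simp: R_def k_def\<close>)
  then show ?thesis using sum_gain[of K] by (simp add: R_def k_def atLeast0LessThan)
qed

end

section \<open>From greedy solutions to runs, and from single extensions to the infimum\<close>

lemma greedy_solution_run:
  assumes "matroid X \<I>" "powerset_polymatroid X g" "\<And>A. A \<in> \<I> \<Longrightarrow> g A = f A"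
    and "greedy_solution X \<I> f K G" "\<exists>A\<subseteq>X. g A \<noteq> 0"
  obtains r where "greedy_run X g \<I> r K" "G = r ` {..<K}"
proof -
  interpret matroid X \<I> by fact
  obtain s where s: "inj_on s {1..K}" "G = s ` {1..K}"
    "\<forall>i\<in>{1..K}. is_arg_max (\<lambda>x. f (s ` {1..<i} \<union> {x}))
      (\<lambda>x. x \<in> X - s ` {1..<i} \<and> s ` {1..<i} \<union> {x} \<in> \<I>) (s i)"
    using assms(4) unfolding greedy_solution_def by blast
  \<comment> \<open>Shifts the steps \<open>1..K\<close> of \<open>greedy_solution\<close> to
    \<open>0..K - 1\<close>.\<close>
  let ?r = "s \<circ> Suc"
  have img: "?r ` {..<t} = s ` {1..<Suc t}" for t
    by (simp only: image_comp[symmetric] image_Suc_lessThan atLeastLessThanSuc_atLeastAtMost)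
  have step: "insert (?r t) (?r ` {..<t}) \<in> \<I> \<and> (\<forall>x. x \<in> X - ?r ` {..<t} \<and>
      insert x (?r ` {..<t}) \<in> \<I> \<longrightarrow> f (insert x (?r ` {..<t})) \<le> f (insert (?r t) (?r ` {..<t})))"
    if "t < K" for t
    using s(3)[rule_format, of "Suc t"] that unfolding img is_arg_max_def
    by (auto simp: not_less)
  have "greedy_run X g \<I> ?r K"
  proof (intro greedy_run.intro greedy_run_axioms.intro assms(1,2,5))
    show "inj_on ?r {..<K}"
      using s(1) by (intro comp_inj_on) (auto simp: image_Suc_lessThan)
    show "?r ` {..<Suc t} \<in> \<I>" if "t < K" for t
      using step[OF that] by (simp add: lessThan_Suc)
    show "g (insert x (?r ` {..<t})) \<le> g (?r ` {..<Suc t})"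
      if "t < K" "x \<in> X - ?r ` {..<t}" "insert x (?r ` {..<t}) \<in> \<I>" for t x
      using step[OF that(1)] that(2,3) assms(3) by (simp add: lessThan_Suc)
  qed
  moreover have "G = ?r ` {..<K}"
    using s(2) by (simp only: img atLeastLessThanSuc_atLeastAtMost)
  ultimately show ?thesis using that by blast
qed

text \<open>The infimum need not be attained: if \<open>p\<close> exceeded \<open>y\<close> there,
  it would do so on a neighbourhood, which contains some \<open>h a\<close>.\<close>

lemma cINF_le_continuous:
  fixes h :: "'b \<Rightarrow> real" and p :: "real \<Rightarrow> real"
  assumes "A \<noteq> {}" "bdd_below (h ` A)" "isCont p (INF a\<in>A. h a)" "\<And>a. a \<in> A \<Longrightarrow> p (h a) \<le> y"
  shows "p (INF a\<in>A. h a) \<le> y"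
proof (rule ccontr)
  let ?d = "INF a\<in>A. h a"
  assume "\<not> p ?d \<le> y"
  then have "eventually (\<lambda>c. y < p c) (nhds ?d)"
    using assms(3) order_tendstoD(1)[of p "p ?d" "nhds ?d" y]
    by (simp add: continuous_at tendsto_at_iff_tendsto_nhds)
  then obtain e where e: "e > 0" "\<And>c. dist c ?d < e \<Longrightarrow> y < p c"
    unfolding eventually_nhds_metric by blast
  obtain a where a: "a \<in> A" "h a < ?d + e"
    using cINF_less_iff[OF assms(1,2), of "?d + e"] e(1) by auto
  have "?d \<le> h a" using cINF_lower[OF assms(2) a(1)] .
  then have "y < p (h a)" using a(2) by (intro e(2)) (simp add: dist_real_def)
  then show False using assms(4)[OF a(1)] by simp
qed

lemma power_one_minus_div_less_exp:
  fixes d :: real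
  assumes "0 < d" "d \<le> 1" "K > 0"
  shows "(1 - d / real K) ^ K < exp (- d)"
proof -
  have "(1 - d / real K) ^ K < exp (- (d / real K)) ^ K"
    using one_minus_div_bounds(1)[of d K] assms
    by (intro power_strict_mono) (auto simp: exp_minus_greater)
  also have "\<dots> = exp (- d)"
    using assms by (simp add: exp_of_nat_mult[symmetric])
  finally show ?thesis .
qed

theorem theorem5:
  fixes X :: "'a set" and \<I> :: "'a set set" and f :: "'a set \<Rightarrow> real"
    and K :: nat and G Opt :: "'a set" and d :: real
  assumes "matroid X \<I>"
    and "K = matroid_rank \<I>"
    and "polymatroid_fun X \<I> f"
    and "polymatroid_extensions X \<I> f \<noteq> {}"
    and "d = (INF g\<in>polymatroid_extensions X \<I> f. total_curvature X g)"
    and "optimal_solution \<I> f Opt"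
    and "f Opt > 0"
    and "greedy_solution X \<I> f K G"
  shows "f G / f Opt \<ge> 1 / (1 + d) \<and>
    (uniform_matroid X \<I> K \<and> d > 0 \<longrightarrow>
      f G / f Opt \<ge> (1 / d) * (1 - (1 - d / real K) ^ K) \<and>
      (1 / d) * (1 - (1 - d / real K) ^ K) > (1 / d) * (1 - exp (- d)))"
proof -
  interpret matroid X \<I> by fact
  let ?E = "polymatroid_extensions X \<I> f"
  have Opt: "Opt \<in> \<I>" "Opt \<subseteq> X"
    using assms(6) indep_subset_ground by (auto simp: optimal_solution_def is_arg_max_def)
  have "\<I> \<subseteq> Pow X" using indep_subset_ground by blast
  then have finI: "finite \<I>" using finite_ground finite_subset by blast
  have card_Opt: "card Opt \<le> K"
    unfolding assms(2) matroid_rank_def using finI Opt by (intro Max_ge) auto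
  have ext: "powerset_polymatroid X g" "\<And>A. A \<in> \<I> \<Longrightarrow> g A = f A" "\<exists>A\<subseteq>X. g A \<noteq> 0"
    if "g \<in> ?E" for g
  proof -
    show "powerset_polymatroid X g" and ext_eq: "\<And>A. A \<in> \<I> \<Longrightarrow> g A = f A"
      using that finite_ground by (auto simp: polymatroid_extensions_def powerset_polymatroid_def)
    show "\<exists>A\<subseteq>X. g A \<noteq> 0"
      using ext_eq[OF Opt(1)] Opt(2) assms(7) by (intro exI[of _ Opt]) simp
  qed
  obtain g\<^sub>0 where g0: "g\<^sub>0 \<in> ?E" using assms(4) by blast
  have "f {} = 0" using assms(3) by (simp add: polymatroid_fun_def)
  then have "Opt \<noteq> {}" using assms(7) by auto
  then have "card Opt > 0" using Opt finite_ground finite_subset by (auto simp: card_gt_0_iff)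
  then have K: "K > 0" using card_Opt by simp
  have curv: "0 \<le> total_curvature X g" "total_curvature X g \<le> 1" if "g \<in> ?E" for g
    using ext[OF that] powerset_polymatroid.total_curvature_nonneg
      powerset_polymatroid.total_curvature_le_1 by blast+
  have bdd: "bdd_below (total_curvature X ` ?E)" using curv by (intro bdd_belowI2)
  have d0: "0 \<le> d" unfolding assms(5) using assms(4) curv by (intro cINF_greatest)
  have d1: "d \<le> 1" unfolding assms(5) using cINF_lower[OF bdd g0] curv[OF g0] by simp
  have bounds: "f Opt \<le> (1 + total_curvature X g) * f G \<and>
      (uniform_matroid X \<I> K \<longrightarrow> f Opt * greedy_ratio (total_curvature X g) K K \<le> f G) \<and> 0 \<le> f G"
    if g: "g \<in> ?E" for g
  proof -
    note e = ext[OF g]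
    obtain r where r: "greedy_run X g \<I> r K" "G = r ` {..<K}"
      using greedy_solution_run[OF assms(1) e(1,2) assms(8) e(3)] .
    interpret greedy_run X g \<I> r K by fact
    have "G \<in> \<I>" using S_indep r(2) by simp
    then have eqs: "g G = f G" "0 \<le> g G" using e(2) nonneg indep_subset_ground by blast+
    have "g Opt * greedy_ratio curv K K \<le> g G" if "uniform_matroid X \<I> K"
      using uniform_bound[OF _ Opt(2) card_Opt] that
      unfolding r(2) uniform_matroid_def by blast
    then show ?thesis
      using matroid_bound[OF Opt(1) card_Opt] eqs unfolding e(2)[OF Opt(1)] r(2)[symmetric]
      by auto
  qed
  have fG: "f G > 0" using bounds[OF g0] assms(7) by (cases "f G = 0") auto
  \<comment> \<open>Solved for the curvature, the matroid bound says that
    \<open>f Opt / f G - 1\<close> is a lower bound of all curvatures, hence of their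
    infimum.\<close>
  have "f Opt / f G - 1 \<le> d"
    unfolding assms(5)
    using assms(4) bounds fG by (intro cINF_greatest) (auto simp: field_simps)
  then have first: "f G / f Opt \<ge> 1 / (1 + d)"
    using fG d0 assms(7) by (simp add: field_simps)
  have second: "f G / f Opt \<ge> (1 / d) * (1 - (1 - d / real K) ^ K)"
    if "uniform_matroid X \<I> K" "d > 0"
  proof -
    \<comment> \<open>The ratio is a polynomial in \<open>c\<close>, so the bound passes to the
      infimum before it is put into closed form.\<close>
    have "isCont (\<lambda>c. greedy_ratio c K K) (INF g\<in>?E. total_curvature X g)"
      unfolding greedy_ratio_def using K by (intro continuous_intros) auto
    then have "greedy_ratio d K K \<le> f G / f Opt"
      unfolding assms(5)
      using cINF_le_continuous[OF assms(4) bdd, of "\<lambda>c. greedy_ratio c K K" "f G / f Opt"]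
        bounds that(1) assms(7) by (simp add: field_simps)
    then show ?thesis
      using mult_greedy_ratio[OF K, of d K, symmetric] that(2) by simp
  qed
  have third: "(1 / d) * (1 - (1 - d / real K) ^ K) > (1 / d) * (1 - exp (- d))" if "d > 0"
    using power_one_minus_div_less_exp[OF that d1 K] that
    by (intro mult_strict_left_mono) auto
  show ?thesis using first second third by blast
qed

end
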